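(* Let $\mathcal{A}\in\mathbb{R}^{n_1\times\cdots\times n_k}$, let $\gamma_j$ be a nonempty subset of $[n_j]$ for $j=1,\ldots,k$, and let $\mathcal{B}=\mathcal{A}[\gamma_1,\ldots,\gamma_k]$. Then ${\rm mr}(\mathcal{A})\ge{\rm mr}(\mathcal{B})$ and ${\rm Mr}(\mathcal{A})\ge{\rm Mr}(\mathcal{B})$.
   Context: $\mathcal{A}[\gamma_1,\ldots,\gamma_k]$ is the subtensor of $\mathcal{A}$ consisting of the entries $a_{i_1\cdots i_k}$ with $i_j\in\gamma_j$ for all $j$. For a real tensor $\mathcal{A}$, $\mathcal{Q}(\mathcal{A})$ is the set of real tensors with the same entrywise sign pattern as $\mathcal{A}$. A rank one tensor is $\alpha_1\otimes\cdots\otimes\alpha_k$ with nonzero vectors $\alpha_j$, entries $(\alpha_1)_{i_1}\cdots(\alpha_k)_{i_k}$; ${\rm rank}(\mathcal{A})$ is the smallest number of rank one tensors summing to $\mathcal{A}$. ${\rm mr}(\mathcal{A})=\min\{{\rm rank}(\mathcal{B}):\mathcal{B}\in\mathcal{Q}(\mathcal{A})\}$, ${\rm Mr}(\mathcal{A})=\max\{{\rm rank}(\mathcal{B}):\mathcal{B}\in\mathcal{Q}(\mathcal{A})\}$. *)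

theory Defs
  imports Complex_Main "HOL-Library.FuncSet"
begin

text \<open>
  A real tensor of format \<open>n\<^sub>1 \<times> \<dots> \<times> n\<^sub>k\<close>, given by \<open>ns = [n\<^sub>1, \<dots>, n\<^sub>k]\<close>, is a function on multi-indices
  (lists of length \<open>k\<close>). Indices are 0-based, so \<open>{..<n}\<close> plays the role of \<open>[n] = {1, \<dots>, n}\<close>.
  The functions are extensional, so that equality in \<open>tensors ns\<close> is entrywise equality.
\<close>

definition tensor_index :: "nat list \<Rightarrow> nat list set" where
  "tensor_index ns = {i. length i = length ns \<and> (\<forall>j<length ns. i ! j < ns ! j)}"

definition tensors :: "nat list \<Rightarrow> (nat list \<Rightarrow> real) set" where
  "tensors ns = (tensor_index ns \<rightarrow>\<^sub>E UNIV)"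

definition rank_one_tensor :: "nat list \<Rightarrow> (nat list \<Rightarrow> real) \<Rightarrow> bool" where
  "rank_one_tensor ns T \<longleftrightarrow>
    (\<exists>\<alpha> :: nat \<Rightarrow> nat \<Rightarrow> real.
      (\<forall>j<length ns. \<exists>l<ns ! j. \<alpha> j l \<noteq> 0) \<and>
      T = (\<lambda>i\<in>tensor_index ns. \<Prod>j<length ns. \<alpha> j (i ! j)))"

text \<open>The zero tensor is the empty sum, hence has rank 0.\<close>

definition tensor_rank :: "nat list \<Rightarrow> (nat list \<Rightarrow> real) \<Rightarrow> nat" where
  "tensor_rank ns A =
    (LEAST r. \<exists>T :: nat \<Rightarrow> nat list \<Rightarrow> real.
      (\<forall>m<r. rank_one_tensor ns (T m)) \<and>
      A = (\<lambda>i\<in>tensor_index ns. \<Sum>m<r. T m i))"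

definition sign_class :: "nat list \<Rightarrow> (nat list \<Rightarrow> real) \<Rightarrow> (nat list \<Rightarrow> real) set" where
  "sign_class ns A = {B \<in> tensors ns. \<forall>i\<in>tensor_index ns. sgn (B i) = sgn (A i)}"

text \<open>
  For \<open>ns \<noteq> []\<close> a tensor is a sum of at most \<open>n\<^sub>1 \<cdots> n\<^sub>k\<close> rank one tensors (one for each nonzero
  entry), so the \<open>LEAST\<close> above and the \<open>Min\<close> and \<open>Max\<close> below are attained.
\<close>

definition min_rank :: "nat list \<Rightarrow> (nat list \<Rightarrow> real) \<Rightarrow> nat" where
  "min_rank ns A = Min (tensor_rank ns ` sign_class ns A)"

definition max_rank :: "nat list \<Rightarrow> (nat list \<Rightarrow> real) \<Rightarrow> nat" where
  "max_rank ns A = Max (tensor_rank ns ` sign_class ns A)"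

text \<open>
  The subtensor \<open>A[\<gamma>\<^sub>1, \<dots>, \<gamma>\<^sub>k]\<close> is a tensor of format \<open>|\<gamma>\<^sub>1| \<times> \<dots> \<times> |\<gamma>\<^sub>k|\<close>: position \<open>l\<close> in direction \<open>j\<close>
  refers to the \<open>l\<close>-th smallest element of \<open>\<gamma>\<^sub>j\<close>.
\<close>

definition subtensor :: "(nat list \<Rightarrow> real) \<Rightarrow> nat set list \<Rightarrow> (nat list \<Rightarrow> real)" where
  "subtensor A \<gamma>s =
    (\<lambda>i\<in>tensor_index (map card \<gamma>s). A (map2 (\<lambda>\<gamma> l. sorted_list_of_set \<gamma> ! l) \<gamma>s i))"

end

theory Submission
  imports Defs
begin

text \<open>
  Restricting the vectors of a rank one decomposition of a tensor to \<open>\<gamma>\<^sub>1, \<dots>, \<gamma>\<^sub>k\<close> decomposes the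
  subtensor, so the rank does not increase. Moreover, every tensor with the sign pattern of the
  subtensor is the subtensor of a tensor with the sign pattern of \<open>A\<close>: fill up with entries of \<open>A\<close>.
\<close>

text \<open>
  Unlike in \<open>rank_one_tensor\<close>, the vectors may vanish here. This makes the notion stable under taking
  subtensors, and dropping the zero summands recovers genuine rank one decompositions.
\<close>

definition product_sum :: "nat list \<Rightarrow> (nat list \<Rightarrow> real) \<Rightarrow> nat \<Rightarrow> bool" where
  "product_sum ns A r \<longleftrightarrow>
    (\<exists>\<alpha> :: nat \<Rightarrow> nat \<Rightarrow> nat \<Rightarrow> real.
      A = (\<lambda>i\<in>tensor_index ns. \<Sum>m<r. \<Prod>j<length ns. \<alpha> m j (i ! j)))"

section \<open>Tensor rank through sums of products of vectors\<close>

lemma finite_tensor_index: "finite (tensor_index ns)"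
proof (rule finite_subset)
  \<comment> \<open>Each component is below its dimension, hence below the sum of all dimensions,
    which gives one finite alphabet for all directions.\<close>
  show "tensor_index ns \<subseteq> {i. set i \<subseteq> {..<sum_list ns} \<and> length i = length ns}"
  proof (clarsimp simp: tensor_index_def in_set_conv_nth)
    fix i :: "nat list" and j
    assume "\<forall>j<length ns. i ! j < ns ! j" "j < length ns"
    then show "i ! j < sum_list ns"
      using elem_le_sum_list[of j ns] less_le_trans by blast
  qed
  show "finite {i. set i \<subseteq> {..<sum_list ns} \<and> length i = length ns}"
    by (rule finite_lists_length_eq) simp
qed

lemma product_sum_imp_rank_one_sum:
  assumes "product_sum ns A r"
  shows "\<exists>s\<le>r. \<exists>T. (\<forall>m<s. rank_one_tensor ns (T m)) \<and>
    A = (\<lambda>i\<in>tensor_index ns. \<Sum>m<s. T m i)"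
proof -
  obtain \<alpha> :: "nat \<Rightarrow> nat \<Rightarrow> nat \<Rightarrow> real"
    where A: "A = (\<lambda>i\<in>tensor_index ns. \<Sum>m<r. \<Prod>j<length ns. \<alpha> m j (i ! j))"
    using assms unfolding product_sum_def by blast
  define M where "M = {m. m < r \<and> (\<forall>j<length ns. \<exists>l<ns ! j. \<alpha> m j l \<noteq> 0)}"
  have fin: "finite M" and sub: "M \<subseteq> {..<r}" by (auto simp: M_def)
  obtain h where h: "bij_betw h {0..<card M} M"
    using ex_bij_betw_nat_finite[OF fin] by blast
  define T where "T m = (\<lambda>i\<in>tensor_index ns. \<Prod>j<length ns. \<alpha> (h m) j (i ! j))" for m
  show ?thesis
  proof (intro exI conjI allI impI)
    show "card M \<le> r" using card_mono[OF _ sub] by simp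
    show "rank_one_tensor ns (T m)" if "m < card M" for m
    proof -
      have "h m \<in> M" using h that by (auto simp: bij_betw_def)
      then show ?thesis unfolding rank_one_tensor_def T_def M_def by blast
    qed
    show "A = (\<lambda>i\<in>tensor_index ns. \<Sum>m<card M. T m i)"
      unfolding A
    proof (rule restrict_ext)
      fix i assume i: "i \<in> tensor_index ns"
      have "(\<Sum>m<r. \<Prod>j<length ns. \<alpha> m j (i ! j)) = (\<Sum>m\<in>M. \<Prod>j<length ns. \<alpha> m j (i ! j))"
      proof (rule sum.mono_neutral_right)
        show "\<forall>m\<in>{..<r} - M. (\<Prod>j<length ns. \<alpha> m j (i ! j)) = 0"
          \<comment> \<open>A summand outside \<open>M\<close> has a direction \<open>j\<close>
            whose vector vanishes on all indices below \<open>ns ! j\<close>, in particular at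
            \<open>i ! j\<close>.\<close>
          using i by (fastforce simp: M_def tensor_index_def)
      qed (use sub in auto)
      also have "\<dots> = (\<Sum>m<card M. \<Prod>j<length ns. \<alpha> (h m) j (i ! j))"
        using sum.reindex_bij_betw[OF h, symmetric] by (simp add: atLeast0LessThan)
      also have "\<dots> = (\<Sum>m<card M. T m i)"
        using i by (simp add: T_def)
      finally show "(\<Sum>m<r. \<Prod>j<length ns. \<alpha> m j (i ! j)) = (\<Sum>m<card M. T m i)" .
    qed
  qed
qed

text \<open>Dropping zero summands can only shorten a decomposition, so one whose vectors may vanish
  still bounds the rank from above.\<close>

lemma tensor_rank_le:
  assumes "product_sum ns A r"
  shows "tensor_rank ns A \<le> r"
proof -
  obtain s T where s: "s \<le> r" and T: "\<forall>m<s. rank_one_tensor ns (T m)"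
    and A: "A = (\<lambda>i\<in>tensor_index ns. \<Sum>m<s. T m i)"
    using product_sum_imp_rank_one_sum[OF assms] by blast
  have "tensor_rank ns A \<le> s"
    unfolding tensor_rank_def by (rule Least_le) (use T A in blast)
  with s show ?thesis by simp
qed

text \<open>
  One summand per entry; the entry is absorbed into the first vector, which needs \<open>ns \<noteq> []\<close>.
\<close>

lemma product_sum_card:
  assumes "ns \<noteq> []" "A \<in> tensors ns"
  shows "product_sum ns A (card (tensor_index ns))"
proof -
  let ?I = "tensor_index ns"
  obtain h where h: "bij_betw h {0..<card ?I} ?I"
    using ex_bij_betw_nat_finite[OF finite_tensor_index] by blast
  \<comment> \<open>Products of unit vectors: \<open>\<beta> e\<close> is supported at the single
    entry \<open>e\<close>, with value \<open>A e\<close> there.\<close>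
  define \<beta> :: "nat list \<Rightarrow> nat \<Rightarrow> nat \<Rightarrow> real"
    where "\<beta> e j l = (if l = e ! j then if j = 0 then A e else 1 else 0)" for e j l
  have \<beta>: "(\<Prod>j<length ns. \<beta> e j (i ! j)) = (if e = i then A i else 0)"
    if ie: "i \<in> ?I" "e \<in> ?I" for i e
  proof (cases "e = i")
    case True
    then have "(\<Prod>j<length ns. \<beta> e j (i ! j)) = (\<Prod>j<length ns. if j = 0 then A i else 1)"
      by (simp add: \<beta>_def)
    also have "\<dots> = A i" using assms(1) by simp
    finally show ?thesis using True by simp
  next
    case False
    \<comment> \<open>Distinct multi-indices of equal length differ in some direction, where the
      unit vector contributes the factor 0.\<close>
    then obtain j where j: "j < length ns" "i ! j \<noteq> e ! j"
      using ie nth_equalityI[of e i] unfolding tensor_index_def by force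
    then have "\<beta> e j (i ! j) = 0" by (simp add: \<beta>_def)
    with j(1) have "(\<Prod>j<length ns. \<beta> e j (i ! j)) = 0"
      by (intro prod_zero) auto
    with False show ?thesis by simp
  qed
  have "A = (\<lambda>i\<in>?I. \<Sum>m<card ?I. \<Prod>j<length ns. \<beta> (h m) j (i ! j))"
  proof (rule extensionalityI[of _ ?I])
    fix i assume i: "i \<in> ?I"
    have "(\<Sum>m<card ?I. \<Prod>j<length ns. \<beta> (h m) j (i ! j)) =
        (\<Sum>e\<in>?I. \<Prod>j<length ns. \<beta> e j (i ! j))"
      using sum.reindex_bij_betw[OF h] by (simp add: atLeast0LessThan)
    also have "\<dots> = (\<Sum>e\<in>?I. if e = i then A i else 0)"
      using i by (intro sum.cong) (simp_all add: \<beta>)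
    also have "\<dots> = A i" using i by (simp add: finite_tensor_index)
    finally show "A i = (\<lambda>i\<in>?I. \<Sum>m<card ?I. \<Prod>j<length ns. \<beta> (h m) j (i ! j)) i"
      using i by simp
  qed (use assms(2) in \<open>auto simp: tensors_def PiE_def\<close>)
  then show ?thesis unfolding product_sum_def by (intro exI[of _ "\<lambda>m. \<beta> (h m)"])
qed

text \<open>The \<open>LEAST\<close> in the definition of rank is attained because the entrywise
  decomposition shows that some decomposition exists.\<close>

lemma product_sum_tensor_rank:
  assumes "ns \<noteq> []" "A \<in> tensors ns"
  shows "product_sum ns A (tensor_rank ns A)"
proof -
  let ?P = "\<lambda>r. \<exists>T :: nat \<Rightarrow> nat list \<Rightarrow> real.
    (\<forall>m<r. rank_one_tensor ns (T m)) \<and> A = (\<lambda>i\<in>tensor_index ns. \<Sum>m<r. T m i)"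
  have "\<exists>s. ?P s"
    using product_sum_imp_rank_one_sum[OF product_sum_card[OF assms]] by blast
  then have "?P (tensor_rank ns A)"
    unfolding tensor_rank_def by (rule LeastI_ex)
  then obtain T where T: "\<And>m. m < tensor_rank ns A \<Longrightarrow> rank_one_tensor ns (T m)"
    and A: "A = (\<lambda>i\<in>tensor_index ns. \<Sum>m<tensor_rank ns A. T m i)" by blast
  have "\<forall>m. \<exists>\<alpha> :: nat \<Rightarrow> nat \<Rightarrow> real. m < tensor_rank ns A \<longrightarrow>
      T m = (\<lambda>i\<in>tensor_index ns. \<Prod>j<length ns. \<alpha> j (i ! j))"
    using T unfolding rank_one_tensor_def by blast
  then obtain \<alpha> :: "nat \<Rightarrow> nat \<Rightarrow> nat \<Rightarrow> real" where "\<And>m. m < tensor_rank ns A \<Longrightarrow>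
      T m = (\<lambda>i\<in>tensor_index ns. \<Prod>j<length ns. \<alpha> m j (i ! j))" by metis
  then have "(\<lambda>i\<in>tensor_index ns. \<Sum>m<tensor_rank ns A. T m i) =
      (\<lambda>i\<in>tensor_index ns. \<Sum>m<tensor_rank ns A. \<Prod>j<length ns. \<alpha> m j (i ! j))"
    by (intro restrict_ext sum.cong) auto
  with A show ?thesis unfolding product_sum_def by (intro exI[of _ \<alpha>] trans[OF A])
qed

text \<open>The number of entries bounds all these ranks at once; finiteness gives
  \<open>Min\<close> and \<open>Max\<close> their meaning.\<close>

lemma finite_tensor_rank_sign_class:
  assumes "ns \<noteq> []"
  shows "finite (tensor_rank ns ` sign_class ns A)"
proof (rule finite_subset)
  show "tensor_rank ns ` sign_class ns A \<subseteq> {..card (tensor_index ns)}"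
    using assms by (auto simp: sign_class_def intro: tensor_rank_le product_sum_card)
qed simp

section \<open>Subtensors, their ranks and sign classes\<close>

text \<open>Isolating the index map makes a subtensor a composition with it, so that injectivity of
  the map can be used to extend tensors.\<close>

definition subindex :: "nat set list \<Rightarrow> nat list \<Rightarrow> nat list" where
  "subindex \<gamma>s i = map2 (\<lambda>\<gamma> l. sorted_list_of_set \<gamma> ! l) \<gamma>s i"

lemma subtensor_alt:
  "subtensor A \<gamma>s = (\<lambda>i\<in>tensor_index (map card \<gamma>s). A (subindex \<gamma>s i))"
  by (simp add: subtensor_def subindex_def)

lemma subtensor_in_tensors: "subtensor A \<gamma>s \<in> tensors (map card \<gamma>s)"
  by (simp add: subtensor_def tensors_def)

lemma subindex_nth:
  assumes "i \<in> tensor_index (map card \<gamma>s)" "j < length \<gamma>s"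
  shows "subindex \<gamma>s i ! j = sorted_list_of_set (\<gamma>s ! j) ! (i ! j)"
  using assms by (simp add: subindex_def tensor_index_def)

context
  fixes ns :: "nat list" and \<gamma>s :: "nat set list"
  assumes len: "length \<gamma>s = length ns"
    and sub: "\<And>j. j < length ns \<Longrightarrow> \<gamma>s ! j \<subseteq> {..<ns ! j}"
begin

lemma subindex_in_tensor_index:
  assumes "i \<in> tensor_index (map card \<gamma>s)"
  shows "subindex \<gamma>s i \<in> tensor_index ns"
proof -
  have "subindex \<gamma>s i ! j < ns ! j" if j: "j < length ns" for j
  proof -
    \<comment> \<open>Finiteness matters: \<open>sorted_list_of_set\<close> of an infinite set is
      the empty list.\<close>
    have fin: "finite (\<gamma>s ! j)" using sub[OF j] finite_subset by blast
    have "i ! j < card (\<gamma>s ! j)" using assms j len by (auto simp: tensor_index_def)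
    then have "sorted_list_of_set (\<gamma>s ! j) ! (i ! j) \<in> \<gamma>s ! j"
      using nth_mem[of "i ! j" "sorted_list_of_set (\<gamma>s ! j)"] fin by simp
    then show ?thesis using sub[OF j] j len assms by (auto simp: subindex_nth)
  qed
  then show ?thesis using assms len by (simp add: tensor_index_def subindex_def)
qed

text \<open>A sorted list of a set has no repetitions, so in each direction the position can be
  recovered from the element.\<close>

lemma inj_on_subindex: "inj_on (subindex \<gamma>s) (tensor_index (map card \<gamma>s))"
proof (rule inj_onI)
  fix i i' assume i: "i \<in> tensor_index (map card \<gamma>s)" "i' \<in> tensor_index (map card \<gamma>s)"
    and eq: "subindex \<gamma>s i = subindex \<gamma>s i'"
  show "i = i'"
  proof (rule nth_equalityI)
    show "length i = length i'" using i by (simp add: tensor_index_def)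
    fix j assume "j < length i"
    then have j: "j < length \<gamma>s" using i by (simp add: tensor_index_def)
    have "sorted_list_of_set (\<gamma>s ! j) ! (i ! j) = sorted_list_of_set (\<gamma>s ! j) ! (i' ! j)"
      using eq j i by (metis subindex_nth)
    moreover have "i ! j < card (\<gamma>s ! j)" "i' ! j < card (\<gamma>s ! j)"
      using i j by (auto simp: tensor_index_def)
    ultimately show "i ! j = i' ! j"
      by (simp add: nth_eq_iff_index_eq)
  qed
qed

lemma product_sum_subtensor:
  assumes "product_sum ns A r"
  shows "product_sum (map card \<gamma>s) (subtensor A \<gamma>s) r"
proof -
  obtain \<alpha> :: "nat \<Rightarrow> nat \<Rightarrow> nat \<Rightarrow> real"
    where A: "A = (\<lambda>i\<in>tensor_index ns. \<Sum>m<r. \<Prod>j<length ns. \<alpha> m j (i ! j))"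
    using assms unfolding product_sum_def by blast
  have "subtensor A \<gamma>s = (\<lambda>i\<in>tensor_index (map card \<gamma>s). \<Sum>m<r.
      \<Prod>j<length (map card \<gamma>s). \<alpha> m j (sorted_list_of_set (\<gamma>s ! j) ! (i ! j)))"
    unfolding subtensor_alt
    by (intro restrict_ext) (simp add: A subindex_in_tensor_index subindex_nth len)
  then show ?thesis unfolding product_sum_def
    \<comment> \<open>The new vectors keep the coordinates in \<open>\<gamma>s ! j\<close>, in
      increasing order; they may vanish even if the old ones do not.\<close>
    by (intro exI[of _ "\<lambda>m j l. \<alpha> m j (sorted_list_of_set (\<gamma>s ! j) ! l)"])
qed

lemma tensor_rank_subtensor_le:
  assumes "ns \<noteq> []" "A \<in> tensors ns"
  shows "tensor_rank (map card \<gamma>s) (subtensor A \<gamma>s) \<le> tensor_rank ns A"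
  by (intro tensor_rank_le product_sum_subtensor product_sum_tensor_rank assms)

text \<open>Restriction preserves signs, which serves the minimum; conversely every member extends
  to a tensor with the signs of \<open>A\<close>, which serves the maximum.\<close>

lemma sign_class_subtensor:
  assumes "A \<in> tensors ns"
  shows "sign_class (map card \<gamma>s) (subtensor A \<gamma>s) = (\<lambda>D. subtensor D \<gamma>s) ` sign_class ns A"
    (is "?L = ?R")
proof
  show "?R \<subseteq> ?L"
    using subtensor_in_tensors
    by (auto simp: sign_class_def subtensor_alt subindex_in_tensor_index)
  show "?L \<subseteq> ?R"
  proof
    fix C assume C: "C \<in> ?L"
    let ?J = "tensor_index (map card \<gamma>s)"
    \<comment> \<open>Selected positions take their entry from \<open>C\<close>, through the inverse
      of the injective index map; all others keep the entry of \<open>A\<close>.\<close>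
    define D where "D = (\<lambda>i\<in>tensor_index ns.
      if i \<in> subindex \<gamma>s ` ?J then C (inv_into ?J (subindex \<gamma>s) i) else A i)"
    have D: "D (subindex \<gamma>s i) = C i" if "i \<in> ?J" for i
      using that by (simp add: D_def subindex_in_tensor_index inv_into_f_f[OF inj_on_subindex])
    have "sgn (D i) = sgn (A i)" if i: "i \<in> tensor_index ns" for i
    proof (cases "i \<in> subindex \<gamma>s ` ?J")
      case True
      then show ?thesis using C by (auto simp: D sign_class_def subtensor_alt)
    next
      case False
      then show ?thesis using i by (simp add: D_def)
    qed
    then have "D \<in> sign_class ns A" by (simp add: sign_class_def tensors_def D_def)
    moreover have "C = subtensor D \<gamma>s"
      using C D
      by (intro extensionalityI[of _ ?J])
        (auto simp: subtensor_alt sign_class_def tensors_def PiE_def)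
    ultimately show "C \<in> ?R" by blast
  qed
qed

end

theorem theorem3p4:
  fixes ns :: "nat list" and A B :: "nat list \<Rightarrow> real" and \<gamma>s :: "nat set list"
  assumes "ns \<noteq> []"
    and "A \<in> tensors ns"
    and "length \<gamma>s = length ns"
    and "\<And>j. j < length ns \<Longrightarrow> \<gamma>s ! j \<noteq> {} \<and> \<gamma>s ! j \<subseteq> {..<ns ! j}"
    and "B = subtensor A \<gamma>s"
  shows "min_rank ns A \<ge> min_rank (map card \<gamma>s) B \<and> max_rank ns A \<ge> max_rank (map card \<gamma>s) B"
proof
  let ?S = "sign_class ns A" and ?S' = "sign_class (map card \<gamma>s) B"
  let ?rk = "tensor_rank ns" and ?rk' = "tensor_rank (map card \<gamma>s)"
  have sub: "\<And>j. j < length ns \<Longrightarrow> \<gamma>s ! j \<subseteq> {..<ns ! j}" using assms(4) by blast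
  have S': "?S' = (\<lambda>D. subtensor D \<gamma>s) ` ?S"
    unfolding assms(5) by (rule sign_class_subtensor[OF assms(3) sub assms(2)])
  have le: "?rk' (subtensor D \<gamma>s) \<le> ?rk D" if "D \<in> ?S" for D
    using tensor_rank_subtensor_le[OF assms(3) sub assms(1)] that
    by (simp add: sign_class_def)
  \<comment> \<open>\<open>A\<close> and its subtensor witness that both minima and maxima range
    over nonempty sets.\<close>
  have "A \<in> ?S" using assms(2) by (simp add: sign_class_def)
  then have ne: "?rk ` ?S \<noteq> {}" "?rk' ` ?S' \<noteq> {}" using S' by auto
  have "map card \<gamma>s \<noteq> []" using assms(1,3) by auto
  then have fin: "finite (?rk ` ?S)" "finite (?rk' ` ?S')"
    using assms(1) by (auto intro: finite_tensor_rank_sign_class)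
  \<comment> \<open>The subtensor of a minimizer for \<open>A\<close> competes in the minimum for
    \<open>B\<close>.\<close>
  obtain D where "D \<in> ?S" "min_rank ns A = ?rk D"
    using Min_in[OF fin(1) ne(1)] unfolding min_rank_def by blast
  moreover from \<open>D \<in> ?S\<close> have "Min (?rk' ` ?S') \<le> ?rk' (subtensor D \<gamma>s)"
    using fin(2) S' by (intro Min_le) auto
  ultimately show "min_rank ns A \<ge> min_rank (map card \<gamma>s) B"
    using le by (fastforce simp: min_rank_def)
  \<comment> \<open>A maximizer for \<open>B\<close> extends to some \<open>D\<close>, which
    competes in the maximum for \<open>A\<close>.\<close>
  obtain D where "D \<in> ?S" "max_rank (map card \<gamma>s) B = ?rk' (subtensor D \<gamma>s)"
    using Max_in[OF fin(2) ne(2)] S' unfolding max_rank_def by auto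
  moreover from \<open>D \<in> ?S\<close> have "?rk D \<le> Max (?rk ` ?S)"
    using fin(1) by (intro Max_ge) auto
  ultimately show "max_rank ns A \<ge> max_rank (map card \<gamma>s) B"
    using le by (fastforce simp: max_rank_def)
qed

end
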